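(* Let $\alpha,\beta,\gamma,p,x,y\in\mathbb{C}$ with $\mathrm{Re}(\alpha)>0$, $\mathrm{Re}(p)>0$, $\mathrm{Re}(x)>0$, $\mathrm{Re}(1-y)>0$. Then $${}^{ML}B_{p}(x,1-y)=\sum_{n=0}^{\infty}\frac{(y)_n}{n!}\;{}^{ML}B_{p}(x+n,1).$$
   Context: The three-parameter Mittag-Leffler function is $E_{\alpha,\beta}^{\gamma}(z)=\sum_{n=0}^{\infty}\frac{(\gamma)_n}{\Gamma(\alpha n+\beta)}\frac{z^n}{n!}$ for $\alpha,\beta,\gamma\in\mathbb{C}$, $\mathrm{Re}(\alpha)>0$, where $(\gamma)_n=\gamma(\gamma+1)\cdots(\gamma+n-1)$, $(\gamma)_0=1$. The ML-generalized beta function is ${}^{ML}B_{p}(x,y)=\int_{0}^{1}t^{x-1}(1-t)^{y-1}E_{\alpha,\beta}^{\gamma}\left(-\frac{p}{t(1-t)}\right)dt$ for $\mathrm{Re}(p)>0$, $\mathrm{Re}(x)>0$, $\mathrm{Re}(y)>0$, $\mathrm{Re}(\alpha)>0$ (the parameters $\alpha,\beta,\gamma$ are suppressed in the notation).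
   Formalization: The integrals defining B_p(x,1-y) and B_p(x,1) are additionally assumed to converge (possibly conditionally); the stated conditions do not ensure this: for α=β=1, γ=-1, x=2, y=-1 every B_p(x+n,1) diverges while B_p(x,1-y) is finite. *)

theory Defs
  imports "HOL-Analysis.Analysis"
begin

text \<open>
  The reciprocal Gamma function \<open>rGamma\<close> is used so that a term whose \<open>\<alpha> n + \<beta>\<close> is a pole of
  Gamma contributes \<open>0\<close>. The series converges for every \<open>z\<close> when \<open>Re \<alpha> > 0\<close>.
\<close>

definition mittag_leffler3 :: "complex \<Rightarrow> complex \<Rightarrow> complex \<Rightarrow> complex \<Rightarrow> complex" where
  "mittag_leffler3 \<alpha> \<beta> \<gamma> z =
     (\<Sum>n. pochhammer \<gamma> n * rGamma (\<alpha> * of_nat n + \<beta>) * (z ^ n / fact n))"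

definition beta_ML_integrand ::
  "complex \<Rightarrow> complex \<Rightarrow> complex \<Rightarrow> complex \<Rightarrow> complex \<Rightarrow> complex \<Rightarrow> real \<Rightarrow> complex" where
  "beta_ML_integrand \<alpha> \<beta> \<gamma> p x y t =
     of_real t powr (x - 1) * of_real (1 - t) powr (y - 1) *
       mittag_leffler3 \<alpha> \<beta> \<gamma> (- p / of_real (t * (1 - t)))"

text \<open>
  The integral is the Henstock-Kurzweil integral, which covers both absolutely convergent
  and improper, conditionally convergent integrals over \<open>(0, 1)\<close>. Convergence does not follow from
  \<open>Re p > 0\<close>, \<open>Re x > 0\<close>, \<open>Re y > 0\<close> and \<open>Re \<alpha> > 0\<close> alone: for \<open>\<alpha> = \<beta> = 1\<close>, \<open>\<gamma> = -1\<close> the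
  Mittag-Leffler factor is \<open>1 + p / (t * (1 - t))\<close>, and the integral diverges for \<open>Re y \<le> 1\<close>.
  When it diverges, \<open>beta_ML\<close> has the meaningless value \<open>0\<close>.
\<close>

definition beta_ML ::
  "complex \<Rightarrow> complex \<Rightarrow> complex \<Rightarrow> complex \<Rightarrow> complex \<Rightarrow> complex \<Rightarrow> complex" where
  "beta_ML \<alpha> \<beta> \<gamma> p x y = integral {0..1} (beta_ML_integrand \<alpha> \<beta> \<gamma> p x y)"

end

theory Submission
  imports Defs
begin

text \<open>
  With \<open>f t = t powr (x - 1) * E(-p / (t (1 - t)))\<close> the theorem integrates the binomial series of \<open>(1 - t) powr (-y)\<close>
  against \<open>f\<close> term by term. Only the integrability of \<open>f\<close> and \<open>g t = f t (1 - t) powr (-y)\<close> matters, and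
  since both may be merely conditionally integrable, dominated convergence is replaced by bounds on
  the total variation of multipliers, via the second mean value theorem. If \<open>S n\<close> is the \<open>n\<close>-th partial
  sum, then \<open>f * S n = g * \<phi>\<close> with \<open>\<phi> t = S n t * (1 - t) powr y\<close>, and the recurrence of the coefficients
  collapses the derivative to \<open>\<phi>' t = - (pochhammer y (n + 1) / n!) t ^ n (1 - t) powr (y - 1)\<close>. As the
  Pochhammer quotient is \<open>O(n powr Re y)\<close>, the variation of \<open>\<phi>\<close> is bounded on \<open>[0, 1 - 1/n]\<close> uniformly in
  \<open>n\<close> and tends to \<open>0\<close> on each \<open>[0, c]\<close> with \<open>c < 1\<close>. On \<open>[1 - 1/n, 1]\<close> it is still bounded if \<open>Re y > 0\<close>;
  if \<open>Re y \<le> 0\<close>, \<open>S n\<close> itself is bounded there and of bounded variation, so that \<open>f * S n\<close> and \<open>g\<close> both have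
  small integrals.
\<close>

section \<open>Multipliers of bounded variation in Henstock-Kurzweil integrals\<close>

lemma integral_mult_mono_bound:
  fixes f P :: "real \<Rightarrow> real"
  assumes "f integrable_on {a..b}" and "a \<le> b" and "P a = 0"
    and P: "\<And>s t. a \<le> s \<Longrightarrow> s \<le> t \<Longrightarrow> t \<le> b \<Longrightarrow> P s \<le> P t"
    and M: "\<And>s t. a \<le> s \<Longrightarrow> s \<le> t \<Longrightarrow> t \<le> b \<Longrightarrow> \<bar>integral {s..t} f\<bar> \<le> M"
  shows "(\<lambda>t. P t * f t) integrable_on {a..b}"
    and "\<bar>integral {a..b} (\<lambda>t. P t * f t)\<bar> \<le> P b * M"
proof -
  \<comment> \<open>Since \<open>P a = 0\<close>, only the term
    \<open>P b * integral {c..b} f\<close> of the mean value formula survives.\<close>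
  obtain c where c: "c \<in> {a..b}"
    and I: "((\<lambda>t. P t * f t) has_integral (P a * integral {a..c} f + P b * integral {c..b} f)) {a..b}"
    using second_mean_value_theorem_full[OF assms(1,2), of P] P by blast
  show "(\<lambda>t. P t * f t) integrable_on {a..b}"
    using I by blast
  have "0 \<le> P b"
    using P[of a b] assms(2,3) by simp
  then show "\<bar>integral {a..b} (\<lambda>t. P t * f t)\<bar> \<le> P b * M"
    using c M[of c b] by (simp add: integral_unique[OF I] assms(3) abs_mult mult_left_mono)
qed

text \<open>\<open>H\<close> serves as a majorant of the variation function of
  \<open>\<phi>\<close>: dominating increments by increments makes \<open>H\<close> nondecreasing
  and leaves \<open>H b - H a\<close> as a bound for the total variation.\<close>

lemma integral_mult_bv_bound_real:
  fixes f \<phi> H :: "real \<Rightarrow> real"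
  assumes f: "f integrable_on {a..b}" and ab: "a \<le> b"
    and H: "\<And>s t. a \<le> s \<Longrightarrow> s \<le> t \<Longrightarrow> t \<le> b \<Longrightarrow> \<bar>\<phi> t - \<phi> s\<bar> \<le> H t - H s"
    and M: "\<And>s t. a \<le> s \<Longrightarrow> s \<le> t \<Longrightarrow> t \<le> b \<Longrightarrow> \<bar>integral {s..t} f\<bar> \<le> M"
  shows "(\<lambda>t. \<phi> t * f t) integrable_on {a..b}"
    and "\<bar>integral {a..b} (\<lambda>t. \<phi> t * f t)\<bar> \<le> (\<bar>\<phi> a\<bar> + 3 * (H b - H a)) * M"
proof -
  \<comment> \<open>The Jordan decomposition \<open>\<phi> = \<phi> a + P - Q\<close>.\<close>
  define P where "P t = (\<phi> t - \<phi> a) + (H t - H a)" for t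
  define Q where "Q t = H t - H a" for t
  have P: "P s \<le> P t" and Q: "Q s \<le> Q t" if "a \<le> s" "s \<le> t" "t \<le> b" for s t
    using H[OF that] by (auto simp: P_def Q_def)
  have "P a = 0" "Q a = 0"
    by (auto simp: P_def Q_def)
  note IP = integral_mult_mono_bound[where P = P and M = M, OF f ab \<open>P a = 0\<close> P M]
  note IQ = integral_mult_mono_bound[where P = Q and M = M, OF f ab \<open>Q a = 0\<close> Q M]
  have eq: "(\<lambda>t. \<phi> t * f t) = (\<lambda>t. \<phi> a * f t + (P t * f t - Q t * f t))"
    by (auto simp: P_def Q_def algebra_simps)
  have If: "(\<lambda>t. \<phi> a * f t) integrable_on {a..b}"
    using f by (rule integrable_on_mult_right)
  show "(\<lambda>t. \<phi> t * f t) integrable_on {a..b}"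
    unfolding eq using If IP(1) IQ(1) by (intro integrable_add integrable_diff) auto
  have "integral {a..b} (\<lambda>t. \<phi> t * f t) = \<phi> a * integral {a..b} f
      + (integral {a..b} (\<lambda>t. P t * f t) - integral {a..b} (\<lambda>t. Q t * f t))"
    unfolding eq using If IP(1) IQ(1)
    by (subst integral_add integral_diff; (intro integrable_diff)?; simp)+
  also have "\<bar>\<dots>\<bar> \<le> \<bar>\<phi> a * integral {a..b} f\<bar> + (P b * M + Q b * M)"
    using IP(2) IQ(2) by fastforce
  \<comment> \<open>The constant 3: both summands of \<open>P b\<close> are at most
    \<open>H b - H a\<close>, and \<open>Q b\<close> equals it.\<close>
  also have "\<dots> \<le> \<bar>\<phi> a\<bar> * M + (2 * (H b - H a) * M + (H b - H a) * M)"
  proof -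
    have M0: "0 \<le> M" using M[of a a] ab by simp
    have "\<bar>\<phi> a * integral {a..b} f\<bar> \<le> \<bar>\<phi> a\<bar> * M"
      using M[of a b] ab by (simp add: abs_mult mult_left_mono)
    moreover have "P b * M \<le> 2 * (H b - H a) * M"
      using H[of a b] ab M0 by (intro mult_right_mono) (auto simp: P_def)
    ultimately show ?thesis by (simp add: Q_def)
  qed
  finally show "\<bar>integral {a..b} (\<lambda>t. \<phi> t * f t)\<bar> \<le> (\<bar>\<phi> a\<bar> + 3 * (H b - H a)) * M"
    by (simp add: algebra_simps)
qed

lemma integrable_complex_parts:
  fixes f :: "real \<Rightarrow> complex"
  assumes "f integrable_on S"
  shows "(\<lambda>t. Re (f t)) integrable_on S" and "(\<lambda>t. Im (f t)) integrable_on S"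
    and "integral S (\<lambda>t. Re (f t)) = Re (integral S f)"
    and "integral S (\<lambda>t. Im (f t)) = Im (integral S f)"
  using integrable_linear[OF assms bounded_linear_Re] integrable_linear[OF assms bounded_linear_Im]
    integral_linear[OF assms bounded_linear_Re] integral_linear[OF assms bounded_linear_Im]
  by (simp_all add: o_def)

text \<open>The complex product splits into four real products. The real and imaginary parts of
  \<open>\<phi>\<close> inherit the majorant \<open>H\<close>, those of \<open>f\<close> inherit
  \<open>M\<close>, so each product obeys the real bound; this is the factor 4.\<close>

lemma integral_mult_bv_bound:
  fixes f \<phi> :: "real \<Rightarrow> complex" and H :: "real \<Rightarrow> real"
  assumes f: "f integrable_on {a..b}" and ab: "a \<le> b"
    and H: "\<And>s t. a \<le> s \<Longrightarrow> s \<le> t \<Longrightarrow> t \<le> b \<Longrightarrow> norm (\<phi> t - \<phi> s) \<le> H t - H s"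
    and M: "\<And>s t. a \<le> s \<Longrightarrow> s \<le> t \<Longrightarrow> t \<le> b \<Longrightarrow> norm (integral {s..t} f) \<le> M"
  shows "(\<lambda>t. \<phi> t * f t) integrable_on {a..b}"
    and "norm (integral {a..b} (\<lambda>t. \<phi> t * f t)) \<le> 4 * (norm (\<phi> a) + 3 * (H b - H a)) * M"
proof -
  have fint: "f integrable_on {s..t}" if "a \<le> s" "t \<le> b" for s t
    using integrable_on_subinterval[OF f] that by auto
  have M0: "0 \<le> M" using M[of a a] ab by simp
  have *: "(\<lambda>t. \<psi> t * h t) integrable_on {a..b} \<and>
     \<bar>integral {a..b} (\<lambda>t. \<psi> t * h t)\<bar> \<le> (norm (\<phi> a) + 3 * (H b - H a)) * M"
    if "\<psi> \<in> {\<lambda>t. Re (\<phi> t), \<lambda>t. Im (\<phi> t)}" "h \<in> {\<lambda>t. Re (f t), \<lambda>t. Im (f t)}" for \<psi> h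
  proof -
    have h: "h integrable_on {a..b}"
      using that(2) integrable_complex_parts[OF f] by auto
    have H': "\<bar>\<psi> t - \<psi> s\<bar> \<le> H t - H s" if "a \<le> s" "s \<le> t" "t \<le> b" for s t
      using H[OF that] abs_Re_le_cmod[of "\<phi> t - \<phi> s"] abs_Im_le_cmod[of "\<phi> t - \<phi> s"]
        \<open>\<psi> \<in> _\<close> by auto
    have M': "\<bar>integral {s..t} h\<bar> \<le> M" if "a \<le> s" "s \<le> t" "t \<le> b" for s t
      using M[OF that] abs_Re_le_cmod[of "integral {s..t} f"] abs_Im_le_cmod[of "integral {s..t} f"]
        \<open>h \<in> _\<close> integrable_complex_parts[OF fint, of s t] that by auto
    have "\<bar>\<psi> a\<bar> \<le> norm (\<phi> a)"
      using that(1) abs_Re_le_cmod abs_Im_le_cmod by auto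
    then have "(\<bar>\<psi> a\<bar> + 3 * (H b - H a)) * M \<le> (norm (\<phi> a) + 3 * (H b - H a)) * M"
      using M0 by (intro mult_right_mono) auto
    then show ?thesis
      using integral_mult_bv_bound_real[where \<phi> = \<psi> and H = H and M = M, OF h ab H' M'] by auto
  qed
  define B where "B = (norm (\<phi> a) + 3 * (H b - H a)) * M"
  define R where "R t = Re (\<phi> t) * Re (f t) - Im (\<phi> t) * Im (f t)" for t
  define I where "I t = Re (\<phi> t) * Im (f t) + Im (\<phi> t) * Re (f t)" for t
  note rr = *[of "\<lambda>t. Re (\<phi> t)" "\<lambda>t. Re (f t)"] and ii = *[of "\<lambda>t. Im (\<phi> t)" "\<lambda>t. Im (f t)"]
    and ri = *[of "\<lambda>t. Re (\<phi> t)" "\<lambda>t. Im (f t)"] and ir = *[of "\<lambda>t. Im (\<phi> t)" "\<lambda>t. Re (f t)"]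
  have R: "R integrable_on {a..b}" "\<bar>integral {a..b} R\<bar> \<le> 2 * B"
    using rr ii unfolding R_def [abs_def] B_def
    by (auto intro!: integrable_diff simp: integral_diff)
  have I: "I integrable_on {a..b}" "\<bar>integral {a..b} I\<bar> \<le> 2 * B"
    using ri ir unfolding I_def [abs_def] B_def
    by (auto intro!: integrable_add simp: integral_add)
  have "((\<lambda>t. complex_of_real (R t) + \<i> * complex_of_real (I t)) has_integral
      (complex_of_real (integral {a..b} R) + \<i> * complex_of_real (integral {a..b} I))) {a..b}"
    using R(1) I(1) by (intro has_integral_add has_integral_mult_right has_integral_of_real)
      (auto simp: integrable_integral)
  also have "(\<lambda>t. complex_of_real (R t) + \<i> * complex_of_real (I t)) = (\<lambda>t. \<phi> t * f t)"
    by (auto simp: R_def I_def complex_eq_iff)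
  finally have *: "((\<lambda>t. \<phi> t * f t) has_integral
      (complex_of_real (integral {a..b} R) + \<i> * complex_of_real (integral {a..b} I))) {a..b}" .
  then show "(\<lambda>t. \<phi> t * f t) integrable_on {a..b}" by blast
  have "norm (integral {a..b} (\<lambda>t. \<phi> t * f t)) \<le> \<bar>integral {a..b} R\<bar> + \<bar>integral {a..b} I\<bar>"
    unfolding integral_unique[OF *]
    by (rule order_trans[OF norm_triangle_ineq]) (simp add: norm_mult)
  then show "norm (integral {a..b} (\<lambda>t. \<phi> t * f t)) \<le> 4 * (norm (\<phi> a) + 3 * (H b - H a)) * M"
    using R(2) I(2) unfolding B_def by argo
qed

section \<open>Integrals over subintervals\<close>

text \<open>The indefinite integral is continuous at \<open>b\<close>, so its increments near
  \<open>b\<close> are small. The bound concerns the norm of the integral, because the integral of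
  the norm need not exist.\<close>

lemma integral_norm_bound_near_right:
  fixes f :: "real \<Rightarrow> 'a::banach"
  assumes f: "f integrable_on {a..b}" and "a < b" and "0 < e"
  obtains c where "a < c" "c < b"
    "\<And>s t. c \<le> s \<Longrightarrow> s \<le> t \<Longrightarrow> t \<le> b \<Longrightarrow> norm (integral {s..t} f) \<le> e"
proof -
  let ?F = "\<lambda>t. integral {a..t} f"
  have "continuous_on {a..b} ?F"
    using f by (rule indefinite_integral_continuous_1)
  then obtain d where d: "d > 0" "\<And>t. t \<in> {a..b} \<Longrightarrow> dist t b < d \<Longrightarrow> dist (?F t) (?F b) < e / 2"
    using assms unfolding continuous_on_iff
    by (metis atLeastAtMost_iff half_gt_zero less_imp_le order_refl)
  define c where "c = max ((a + b) / 2) (b - d / 2)"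
  have "a < c" "c < b" using assms d by (auto simp: c_def max_def field_simps)
  moreover have "norm (integral {s..t} f) \<le> e" if "c \<le> s" "s \<le> t" "t \<le> b" for s t
  proof -
    have "f integrable_on {a..t}"
      using integrable_on_subinterval[OF f] that by auto
    then have "integral {s..t} f = ?F t - ?F s"
      using Henstock_Kurzweil_Integration.integral_combine[of a s t f] that \<open>a < c\<close> by (simp add: algebra_simps)
    then have "norm (integral {s..t} f) = dist (?F t) (?F s)"
      by (simp add: dist_norm)
    also have "\<dots> \<le> dist (?F t) (?F b) + dist (?F s) (?F b)"
      by (rule dist_triangle2)
    also have "\<dots> \<le> e / 2 + e / 2"
      using that \<open>a < c\<close> d by (intro add_mono less_imp_le d(2)) (auto simp: c_def dist_real_def)
    finally show ?thesis by simp
  qed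
  ultimately show thesis using that by blast
qed

lemma integral_norm_bound_subintervals:
  fixes f :: "real \<Rightarrow> 'a::banach"
  assumes f: "f integrable_on {a..b}"
  obtains M where "0 \<le> M"
    "\<And>s t. a \<le> s \<Longrightarrow> s \<le> t \<Longrightarrow> t \<le> b \<Longrightarrow> norm (integral {s..t} f) \<le> M"
proof -
  let ?F = "\<lambda>t. integral {a..t} f"
  have "compact (?F ` {a..b})"
    using indefinite_integral_continuous_1[OF f] by (intro compact_continuous_image) auto
  then obtain B where B: "B > 0" "\<And>t. t \<in> {a..b} \<Longrightarrow> norm (?F t) \<le> B"
    by (auto dest!: compact_imp_bounded simp: bounded_pos)
  show thesis
  proof
    show "0 \<le> 2 * B" using B by simp
  next
    fix s t assume st: "a \<le> s" "s \<le> t" "t \<le> b"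
    have "f integrable_on {a..t}"
      using integrable_on_subinterval[OF f] st by auto
    then have "integral {s..t} f = ?F t - ?F s"
      using Henstock_Kurzweil_Integration.integral_combine[of a s t f] st by (simp add: algebra_simps)
    then have "norm (integral {s..t} f) \<le> norm (?F t) + norm (?F s)"
      by (simp add: norm_triangle_ineq4)
    then show "norm (integral {s..t} f) \<le> 2 * B"
      using B(2)[of t] B(2)[of s] st by simp
  qed
qed

section \<open>Partial sums of the binomial series\<close>

text \<open>Divided by n powr y, the quotient is the n-th term of \<open>rGamma_series y\<close>,
  which converges to the reciprocal Gamma function for every y, poles of Gamma included, and hence
  is bounded.\<close>

lemma pochhammer_over_fact_bound:
  fixes y :: complex
  obtains C where "0 < C"
    "\<And>n. n > 0 \<Longrightarrow> norm (pochhammer y (Suc n) / fact n) \<le> C * real n powr Re y"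
proof -
  have "Bseq (rGamma_series y)"
    using rGamma_series_LIMSEQ convergentI convergent_imp_Bseq by blast
  then obtain C where C: "0 < C" "\<And>n. norm (rGamma_series y n) \<le> C"
    by (auto simp: Bseq_def)
  have "norm (pochhammer y (Suc n) / fact n) \<le> C * real n powr Re y" if "n > 0" for n
  proof -
    have "pochhammer y (Suc n) / fact n = rGamma_series y n * exp (y * of_real (ln (of_nat n)))"
      by (simp add: rGamma_series_def)
    moreover have "norm (exp (y * of_real (ln (real n)))) = real n powr Re y"
      using that by (simp add: powr_def)
    ultimately show ?thesis
      using C by (simp add: norm_mult mult_right_mono)
  qed
  with C that show thesis by blast
qed

text \<open>The Taylor polynomial of degree n at 0 of (1 - t) powr (-y).\<close>

definition binomial_sum :: "complex \<Rightarrow> nat \<Rightarrow> real \<Rightarrow> complex" where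
  "binomial_sum y n t = (\<Sum>k\<le>n. pochhammer y k / fact k * of_real t ^ k)"

lemma binomial_sum_0: "binomial_sum y n 0 = 1"
  by (simp add: binomial_sum_def power_0_left if_distrib cong: if_cong)

lemma binomial_sum_powr_deriv:
  assumes "t < 1"
  shows "((\<lambda>t. binomial_sum y n t * of_real (1 - t) powr y) has_vector_derivative
      - (pochhammer y (Suc n) / fact n * of_real t ^ n * of_real (1 - t) powr (y - 1))) (at t)"
proof (induction n)
  have dp: "((\<lambda>z. (1 - z) powr y) has_field_derivative - (y * (1 - of_real t) powr (y - 1)))
      (at (of_real t))"
    using assms by (auto intro!: derivative_eq_intros simp: complex_nonpos_Reals_iff)
  have dp': "((\<lambda>z. of_real (1 - z) powr y) has_vector_derivative
      - (y * (1 - of_real t) powr (y - 1))) (at t)"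
    using has_vector_derivative_real_field[OF dp] by simp
  {
    case 0
    show ?case using dp' by (simp add: binomial_sum_def)
  next
    case (Suc n)
    let ?c = "pochhammer y (Suc n) / fact (Suc n) :: complex"
    let ?w = "of_real (1 - t) powr (y - 1) :: complex"
    have w: "of_real (1 - t) powr y = of_real (1 - t) * ?w"
      using assms by (simp add: powr_diff del: of_real_diff)
    have "((\<lambda>z. ?c * z ^ Suc n * (1 - z) powr y) has_field_derivative
        ?c * (of_nat (Suc n) * of_real t ^ n * of_real (1 - t) powr y - of_real t ^ Suc n * (y * ?w)))
      (at (of_real t))"
    proof -
      have "((\<lambda>z. ?c * z ^ Suc n) has_field_derivative ?c * (of_nat (Suc n) * of_real t ^ n))
          (at (of_real t))"
        using DERIV_cmult[OF DERIV_power[OF DERIV_ident, where n = "Suc n" and x = "of_real t :: complex"], of ?c] by simp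
      from DERIV_mult[OF this dp] show ?thesis
        by (simp add: algebra_simps add_divide_distrib del: of_nat_Suc fact_Suc)
    qed
    from has_vector_derivative_add[OF Suc.IH has_vector_derivative_real_field[OF this]]
    have "((\<lambda>t. binomial_sum y (Suc n) t * of_real (1 - t) powr y) has_vector_derivative
      - (pochhammer y (Suc n) / fact n * of_real t ^ n * ?w) +
      ?c * (of_nat (Suc n) * of_real t ^ n * of_real (1 - t) powr y - of_real t ^ Suc n * (y * ?w))) (at t)"
      by (simp add: binomial_sum_def algebra_simps)
    \<comment> \<open>Writing (1 - t) powr y as (1 - t) times \<open>?w\<close> cancels the terms in
      t ^ n. Two terms in t ^ (n + 1) remain, with factors n + 1 and y, and together they produce
      the next Pochhammer symbol.\<close>
    also have "- (pochhammer y (Suc n) / fact n * of_real t ^ n * ?w) +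
      ?c * (of_nat (Suc n) * of_real t ^ n * of_real (1 - t) powr y - of_real t ^ Suc n * (y * ?w))
      = - (?c * (y + of_nat (Suc n)) * of_real t ^ Suc n * ?w)"
    proof -
      have "pochhammer y (Suc n) / fact n = ?c * of_nat (Suc n)"
        by (simp del: of_nat_Suc)
      then show ?thesis unfolding w by (simp only:) (simp add: algebra_simps add_divide_distrib del: of_nat_Suc fact_Suc)
    qed
    also have "?c * (y + of_nat (Suc n)) = pochhammer y (Suc (Suc n)) / fact (Suc n)"
      by (simp add: pochhammer_Suc)
    finally show ?case .
  }
qed


lemma continuous_on_binomial_sum: "continuous_on A (binomial_sum y n)"
  unfolding binomial_sum_def by (intro continuous_intros)

text \<open>As \<open>Re y \<le> 1\<close>, the power of 1 - x in the derivative is largest at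
  \<open>b\<close> and is pulled out there. The factor x ^ n is kept and integrated: it gives the
  decay on a fixed interval, and its 1 / (n + 1) absorbs the growth when \<open>b\<close> approaches
  1 with n.\<close>

lemma binomial_sum_powr_variation:
  assumes D: "norm (pochhammer y (Suc n) / fact n) \<le> D" and y: "Re y \<le> 1"
    and st: "0 \<le> s" "s \<le> t" "t \<le> b" "b < 1"
  shows "norm (binomial_sum y n t * of_real (1 - t) powr y - binomial_sum y n s * of_real (1 - s) powr y)
    \<le> D * (1 - b) powr (Re y - 1) / real (Suc n) * t ^ Suc n -
      D * (1 - b) powr (Re y - 1) / real (Suc n) * s ^ Suc n"
proof (cases "s = t")
  case False
  with st have "s < t" by simp
  let ?K = "D * (1 - b) powr (Re y - 1)"
  show ?thesis
  proof (rule differentiable_bound_general[where \<phi>' = "\<lambda>x. ?K * x ^ n", OF \<open>s < t\<close>])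
    show "continuous_on {s..t} (\<lambda>t. binomial_sum y n t * of_real (1 - t) powr y)"
      using st by (intro continuous_intros continuous_on_binomial_sum) auto
    show "continuous_on {s..t} (\<lambda>t. ?K / real (Suc n) * t ^ Suc n)"
      by (intro continuous_intros)
    fix x assume x: "s < x" "x < t"
    show "((\<lambda>t. binomial_sum y n t * of_real (1 - t) powr y) has_vector_derivative
        - (pochhammer y (Suc n) / fact n * of_real x ^ n * of_real (1 - x) powr (y - 1))) (at x)"
      using x st by (intro binomial_sum_powr_deriv) auto
    have "((\<lambda>t. ?K / real (Suc n) * t ^ Suc n) has_real_derivative
        ?K / real (Suc n) * (real (Suc n) * x ^ n)) (at x)"
      using DERIV_cmult[OF DERIV_pow[of "Suc n" x UNIV], of "?K / real (Suc n)"]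
      by (simp del: power_Suc of_nat_Suc)
    then show "((\<lambda>t. ?K / real (Suc n) * t ^ Suc n) has_vector_derivative ?K * x ^ n) (at x)"
      by (simp add: has_real_derivative_iff_has_vector_derivative[symmetric] mult.assoc del: of_nat_Suc power_Suc)
    have "norm (of_real (1 - x) powr (y - 1) :: complex) = (1 - x) powr (Re y - 1)"
      using x st by (subst norm_powr_real_powr) auto
    also have "\<dots> \<le> (1 - b) powr (Re y - 1)"
      using x st y by (intro powr_mono2') auto
    finally have "norm (pochhammer y (Suc n) / fact n) * (x ^ n * norm (of_real (1 - x) powr (y - 1) :: complex))
        \<le> D * (x ^ n * (1 - b) powr (Re y - 1))"
      using D x st by (intro mult_mono mult_nonneg_nonneg) (auto intro: order_trans[OF norm_ge_zero])
    then show "norm (- (pochhammer y (Suc n) / fact n * of_real x ^ n * of_real (1 - x) powr (y - 1)))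
        \<le> ?K * x ^ n"
      using x st by (simp add: norm_mult norm_power norm_divide mult_ac del: of_real_diff)
  qed
qed auto

text \<open>Up to the endpoint 1 it is the other factor that is integrated: x ^ n is bounded by 1,
  and (1 - x) powr (Re y - 1) is integrable at 1 because \<open>Re y > 0\<close>.\<close>

lemma binomial_sum_powr_variation_near_1:
  assumes D: "norm (pochhammer y (Suc n) / fact n) \<le> D" and y: "0 < Re y"
    and st: "0 \<le> s" "s \<le> t" "t \<le> 1"
  shows "norm (binomial_sum y n t * of_real (1 - t) powr y - binomial_sum y n s * of_real (1 - s) powr y)
    \<le> - (D / Re y) * (1 - t) powr Re y - - (D / Re y) * (1 - s) powr Re y"
proof (cases "s = t")
  case False
  with st have "s < t" by simp
  show ?thesis
  proof (rule differentiable_bound_general[where \<phi>' = "\<lambda>x. D * (1 - x) powr (Re y - 1)", OF \<open>s < t\<close>])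
    show "continuous_on {s..t} (\<lambda>t. binomial_sum y n t * of_real (1 - t) powr y)"
      using st y by (intro continuous_intros continuous_on_binomial_sum) auto
    show "continuous_on {s..t} (\<lambda>t. - (D / Re y) * (1 - t) powr Re y)"
      using st y by (intro continuous_intros continuous_on_powr') auto
    fix x assume x: "s < x" "x < t"
    show "((\<lambda>t. binomial_sum y n t * of_real (1 - t) powr y) has_vector_derivative
        - (pochhammer y (Suc n) / fact n * of_real x ^ n * of_real (1 - x) powr (y - 1))) (at x)"
      using x st by (intro binomial_sum_powr_deriv) auto
    have "((\<lambda>t. - (D / Re y) * (1 - t) powr Re y) has_real_derivative D * (1 - x) powr (Re y - 1)) (at x)"
      using x st y by (auto intro!: derivative_eq_intros simp: powr_diff)
    then show "((\<lambda>t. - (D / Re y) * (1 - t) powr Re y) has_vector_derivative D * (1 - x) powr (Re y - 1)) (at x)"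
      by (simp only: has_real_derivative_iff_has_vector_derivative)
    have n: "norm (of_real (1 - x) powr (y - 1) :: complex) = (1 - x) powr (Re y - 1)"
      using x st by (subst norm_powr_real_powr) auto
    have "norm (pochhammer y (Suc n) / fact n) * x ^ n \<le> D * 1"
      using D x st by (intro mult_mono power_le_one) (auto intro: order_trans[OF norm_ge_zero])
    then have "norm (pochhammer y (Suc n) / fact n) * x ^ n * (1 - x) powr (Re y - 1)
        \<le> D * (1 - x) powr (Re y - 1)"
      by (intro mult_right_mono) auto
    then show "norm (- (pochhammer y (Suc n) / fact n * of_real x ^ n * of_real (1 - x) powr (y - 1)))
        \<le> D * (1 - x) powr (Re y - 1)"
      using x st n by (simp add: norm_mult norm_power norm_divide del: of_real_diff)
  qed
qed auto

text \<open>\<open>D\<close> bounds the coefficients of the differentiated polynomial, so each of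
  the n + 1 terms is Lipschitz with constant \<open>D\<close>. The growing constant is harmless on
  an interval of length 1/n.\<close>

lemma binomial_sum_lipschitz:
  assumes D: "\<And>k. norm (pochhammer y (Suc k) / fact k) \<le> D"
    and st: "0 \<le> s" "s \<le> t" "t \<le> 1"
  shows "norm (binomial_sum y n t - binomial_sum y n s) \<le> real (Suc n) * D * t - real (Suc n) * D * s"
proof -
  have D0: "0 \<le> D" using D[of 0] norm_ge_zero order_trans by blast
  have "binomial_sum y n t - binomial_sum y n s =
      (\<Sum>k\<le>n. pochhammer y k / fact k * (of_real t ^ k - of_real s ^ k))"
    by (simp add: binomial_sum_def sum_subtractf right_diff_distrib)
  also have "norm \<dots> \<le> (\<Sum>k\<le>n. D * (t - s))"
  proof (rule sum_norm_le)
    fix k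
    show "norm (pochhammer y k / fact k * (of_real t ^ k - of_real s ^ k)) \<le> D * (t - s)"
    proof (cases k)
      case 0
      then show ?thesis using D0 st by simp
    next
      case (Suc m)
      have "norm (of_real t ^ k - of_real s ^ k :: complex) \<le> real k * norm (of_real t - of_real s :: complex)"
        using st by (intro norm_power_diff) auto
      also have "norm (of_real t - of_real s :: complex) = t - s"
        using st by (simp flip: of_real_diff)
      finally have "norm (pochhammer y k / fact k * (of_real t ^ k - of_real s ^ k))
          \<le> norm (pochhammer y k / fact k) * (real k * (t - s))"
        unfolding norm_mult by (intro mult_left_mono) auto
      also have "\<dots> = norm (pochhammer y (Suc m) / fact m) * (t - s)"
        by (simp add: Suc norm_divide norm_mult del: of_nat_Suc)
      also have "\<dots> \<le> D * (t - s)"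
        using D st by (intro mult_right_mono) auto
      finally show ?thesis .
    qed
  qed
  finally show ?thesis by (simp add: algebra_simps)
qed


section \<open>Termwise integration against the binomial series\<close>

theorem sums_integral_binomial_series:
  fixes f :: "real \<Rightarrow> complex" and y :: complex
  assumes y: "Re y < 1" and f: "f integrable_on {0..1}"
    and g: "(\<lambda>t. f t * of_real (1 - t) powr (- y)) integrable_on {0..1}"
  shows "(\<lambda>n. pochhammer y n / fact n * integral {0..1} (\<lambda>t. of_real t ^ n * f t)) sums
    integral {0..1} (\<lambda>t. f t * of_real (1 - t) powr (- y))"
proof -
  define g where "g = (\<lambda>t. f t * of_real (1 - t) powr (- y))"
  define \<phi> where "\<phi> n t = binomial_sum y n t * of_real (1 - t) powr y" for n t
  \<comment> \<open>Away from t = 1 the error \<open>h n\<close> is \<open>\<psi> n * g\<close>. As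
    \<open>\<psi> n\<close> vanishes at 0, bounds on its variation also bound its size.\<close>
  define \<psi> where "\<psi> n t = \<phi> n t - 1" for n t
  define h where "h n t = binomial_sum y n t * f t - g t" for n t
  have gi: "g integrable_on {0..1}" using g by (simp add: g_def)
  obtain C where C: "0 < C"
    "\<And>n. n > 0 \<Longrightarrow> norm (pochhammer y (Suc n) / fact n) \<le> C * real n powr Re y"
    using pochhammer_over_fact_bound[of y] by blast
  obtain M where M: "0 \<le> M" "\<And>s t. 0 \<le> s \<Longrightarrow> s \<le> t \<Longrightarrow> t \<le> 1 \<Longrightarrow> norm (integral {s..t} g) \<le> M"
    using integral_norm_bound_subintervals[OF gi] by blast
  have pow: "(\<lambda>t. of_real t ^ k * f t) integrable_on {0..1}" for k
  proof -
    obtain N where N: "\<And>s t. 0 \<le> s \<Longrightarrow> s \<le> t \<Longrightarrow> t \<le> 1 \<Longrightarrow> norm (integral {s..t} f) \<le> N"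
      using integral_norm_bound_subintervals[OF f] by blast
    have "norm (of_real t ^ k - of_real s ^ k :: complex) \<le> t ^ k - s ^ k" if "0 \<le> s" "s \<le> t" for s t :: real
      using that power_mono[of s t k] by (simp flip: of_real_power of_real_diff)
    then show ?thesis
      by (intro integral_mult_bv_bound(1)[OF f, where M = N and H = "\<lambda>t. t ^ k"]) (use N in auto)
  qed
  have Sf: "((\<lambda>t. binomial_sum y n t * f t) has_integral
      (\<Sum>k\<le>n. pochhammer y k / fact k * integral {0..1} (\<lambda>t. of_real t ^ k * f t))) {0..1}" for n
    unfolding binomial_sum_def sum_distrib_right mult.assoc
    by (intro has_integral_sum has_integral_mult_right integrable_integral pow) auto
  have hi: "h n integrable_on {0..1}" for n
    unfolding h_def using Sf gi by (intro integrable_diff) blast+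
  \<comment> \<open>At t = 1 both powers are 0 by convention and the identity may fail; one point
    does not affect the integral.\<close>
  have hpsi: "integral {u..v} (h n) = integral {u..v} (\<lambda>t. \<psi> n t * g t)" if "0 \<le> u" "v \<le> 1" for u v n
  proof (rule integral_spike[of "{1}"])
    fix t assume "t \<in> {u..v} - {1}"
    then have "of_real (1 - t) powr y * of_real (1 - t) powr (- y) = (1 :: complex)"
      using that by (simp add: powr_minus del: of_real_diff)
    then show "\<psi> n t * g t = h n t"
      by (simp add: \<psi>_def \<phi>_def h_def g_def algebra_simps del: of_real_diff)
  qed simp
  have psi0: "\<psi> n 0 = 0" for n
    by (simp add: \<psi>_def \<phi>_def binomial_sum_0)
  have var: "norm (\<psi> n t - \<psi> n s) \<le>
      C * real n powr Re y * (1 - b) powr (Re y - 1) / real (Suc n) * t ^ Suc n -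
      C * real n powr Re y * (1 - b) powr (Re y - 1) / real (Suc n) * s ^ Suc n"
    if "n > 0" "0 \<le> s" "s \<le> t" "t \<le> b" "b < 1" for n s t b
    using binomial_sum_powr_variation[OF C(2)[OF that(1)] less_imp_le[OF y] that(2-5)]
    by (simp add: \<psi>_def \<phi>_def del: of_nat_Suc)
  \<comment> \<open>This is why the cut is at 1 - 1/n: there (1 - b) powr (Re y - 1) is n powr (1 -
    Re y), so the two powers multiply to n, which the denominator n + 1 absorbs.\<close>
  have scale: "C * real n powr Re y * (1 - (1 - 1 / real n)) powr (Re y - 1) / real (Suc n) \<le> C" if "n > 0" for n
  proof -
    have "real n powr Re y * (1 - (1 - 1 / real n)) powr (Re y - 1) = real n"
      using that by (simp add: powr_divide powr_diff)
    then show ?thesis using C(1) that by (simp add: mult.assoc divide_simps del: of_nat_Suc) 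
  qed
  have var': "norm (\<psi> n t - \<psi> n s) \<le> C * t ^ Suc n - C * s ^ Suc n"
    if "n > 0" "0 \<le> s" "s \<le> t" "t \<le> 1 - 1 / real n" for n s t
  proof -
    have "s ^ Suc n \<le> t ^ Suc n" using that by (intro power_mono) auto
    then have "C * real n powr Re y * (1 - (1 - 1 / real n)) powr (Re y - 1) / real (Suc n) * (t ^ Suc n - s ^ Suc n)
        \<le> C * (t ^ Suc n - s ^ Suc n)"
      using scale[OF that(1)] by (intro mult_right_mono) auto
    then show ?thesis
      using var[OF that(1-4)] that(1) by (simp add: right_diff_distrib)
  qed
  have psi_bound: "norm (\<psi> n t) \<le> C" if "n > 0" "0 \<le> t" "t \<le> 1 - 1 / real n" for n t
  proof -
    have "norm (\<psi> n t) \<le> C * t ^ Suc n"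
      using var'[of n 0 t] that by (simp add: psi0)
    also have "\<dots> \<le> C * 1"
      using C(1) that by (intro mult_left_mono power_le_one) (auto simp: order_trans)
    finally show ?thesis by simp
  qed
  \<comment> \<open>\<open>L\<close> depends on neither n nor \<open>\<epsilon>\<close>, so that
    \<open>\<epsilon>\<close> can be made small afterwards.\<close>
  have tail: "\<exists>L \<ge> 0. \<forall>n>0. \<forall>\<epsilon>.
      (\<forall>s t. 1 - 1 / real n \<le> s \<longrightarrow> s \<le> t \<longrightarrow> t \<le> 1 \<longrightarrow>
        norm (integral {s..t} f) \<le> \<epsilon> \<and> norm (integral {s..t} g) \<le> \<epsilon>) \<longrightarrow>
      norm (integral {1 - 1 / real n..1} (h n)) \<le> L * \<epsilon>"
  proof (cases "0 < Re y")
    case True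
    have "norm (integral {1 - 1 / real n..1} (h n)) \<le> 4 * (C + 3 * (C / Re y)) * \<epsilon>"
      if n: "n > 0" and e: "\<And>s t. 1 - 1 / real n \<le> s \<Longrightarrow> s \<le> t \<Longrightarrow> t \<le> 1 \<Longrightarrow> norm (integral {s..t} g) \<le> \<epsilon>"
      for n \<epsilon>
    proof -
      define a where "a = 1 - 1 / real n"
      have a: "0 \<le> a" "a \<le> 1" using n by (auto simp: a_def)
      have e0: "0 \<le> \<epsilon>" using e[of 1 1] by simp
      \<comment> \<open>Over [1 - 1/n, 1] the increment of this majorant is \<open>C / Re y\<close>
        for every n, since (1 / n) powr Re y cancels n powr Re y.\<close>
      let ?H = "\<lambda>t. - (C * real n powr Re y / Re y) * (1 - t) powr Re y"
      have "norm (integral {a..1} (h n)) = norm (integral {a..1} (\<lambda>t. \<psi> n t * g t))"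
        using a by (simp add: hpsi)
      also have "\<dots> \<le> 4 * (norm (\<psi> n a) + 3 * (?H 1 - ?H a)) * \<epsilon>"
      proof (rule integral_mult_bv_bound(2))
        show "g integrable_on {a..1}" using integrable_on_subinterval[OF gi] a by auto
        show "norm (\<psi> n t - \<psi> n s) \<le> ?H t - ?H s" if "a \<le> s" "s \<le> t" "t \<le> 1" for s t
          using binomial_sum_powr_variation_near_1[OF C(2)[OF n] True, of s t] that a
          by (simp add: \<psi>_def \<phi>_def)
      qed (use a e in \<open>auto simp: a_def\<close>)
      also have "?H 1 - ?H a = C / Re y"
        using n True by (simp add: a_def powr_divide)
      also have "4 * (norm (\<psi> n a) + 3 * (C / Re y)) * \<epsilon> \<le> 4 * (C + 3 * (C / Re y)) * \<epsilon>"
        using psi_bound[OF n a(1)] e0 by (intro mult_right_mono) (auto simp: a_def)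
      finally show ?thesis by (simp add: a_def)
    qed
    then show ?thesis
      using True C(1) by (intro exI[of _ "4 * (C + 3 * (C / Re y))"]) auto
  next
    case False
    \<comment> \<open>Now the bound on the derivative of \<open>\<phi> n\<close> is not integrable
      up to 1, so the integrals of \<open>binomial_sum y n t * f t\<close> and of \<open>g\<close>
      are estimated separately. The \<open>norm y\<close> in \<open>D\<close> covers k = 0, which
      the bound with \<open>C\<close> excludes.\<close>
    define D where "D = max (norm y) C"
    have D: "norm (pochhammer y (Suc k) / fact k) \<le> D" for k
    proof (cases "k = 0")
      case False
      then have "C * real k powr Re y \<le> C * 1"
        using C(1) \<open>\<not> 0 < Re y\<close> powr_mono[of "Re y" 0 "real k"] by (intro mult_left_mono) auto
      with C(2)[of k] False show ?thesis by (simp add: D_def)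
    qed (simp add: D_def)
    have D0: "0 \<le> D" using C(1) by (simp add: D_def)
    have "norm (integral {1 - 1 / real n..1} (h n)) \<le> (4 * (1 + C + 6 * D) + 1) * \<epsilon>"
      if n: "n > 0" and e: "\<And>s t. 1 - 1 / real n \<le> s \<Longrightarrow> s \<le> t \<Longrightarrow> t \<le> 1 \<Longrightarrow>
          norm (integral {s..t} f) \<le> \<epsilon> \<and> norm (integral {s..t} g) \<le> \<epsilon>"
      for n \<epsilon>
    proof -
      define a where "a = 1 - 1 / real n"
      have a: "0 \<le> a" "a \<le> 1" using n by (auto simp: a_def)
      have e0: "0 \<le> \<epsilon>" using e[of 1 1] by simp
      have fa: "f integrable_on {a..1}" and ga: "g integrable_on {a..1}"
        using integrable_on_subinterval[OF f] integrable_on_subinterval[OF gi] a by auto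
      let ?H = "\<lambda>t. real (Suc n) * D * t"
      have H: "norm (binomial_sum y n t - binomial_sum y n s) \<le> ?H t - ?H s"
        if "a \<le> s" "s \<le> t" "t \<le> 1" for s t
        using binomial_sum_lipschitz[OF D, where s = s and t = t] that a by auto
      have ef: "norm (integral {s..t} f) \<le> \<epsilon>" if "a \<le> s" "s \<le> t" "t \<le> 1" for s t
        using e[of s t] that by (simp add: a_def)
      note B = integral_mult_bv_bound[where H = ?H and M = \<epsilon>, OF fa a(2) H ef]
      \<comment> \<open>The partial sum at \<open>a\<close> is bounded through
        \<open>\<phi> n a\<close>: for \<open>Re y \<le> 0\<close> the factor (1 / n) powr Re y is
        at least 1.\<close>
      have "norm (binomial_sum y n a) * 1 \<le> norm (binomial_sum y n a) * (1 / real n) powr Re y"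
      proof (rule mult_left_mono)
        have "1 = real n powr 0" using n by simp
        also have "\<dots> \<le> real n powr (- Re y)" using n False by (intro powr_mono) auto
        finally show "1 \<le> (1 / real n) powr Re y" using n by (simp add: powr_divide powr_minus field_simps)
      qed simp
      also have "\<dots> = norm (\<phi> n a)"
        using n by (simp add: \<phi>_def norm_mult a_def norm_powr_real_powr)
      also have "\<dots> \<le> norm (\<psi> n a) + 1"
        using norm_triangle_ineq[of "\<psi> n a" 1] by (simp add: \<psi>_def)
      also have "\<dots> \<le> 1 + C"
        using psi_bound[OF n a(1)] by (simp add: a_def)
      finally have Sa: "norm (binomial_sum y n a) \<le> 1 + C" by simp
      have "?H 1 - ?H a = D * (real (Suc n) / real n)"
        by (simp add: a_def field_simps)
      also have "\<dots> \<le> D * 2"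
        using n D0 by (intro mult_left_mono) (auto simp: field_simps)
      finally have Ha: "?H 1 - ?H a \<le> D * 2" .
      have "integral {a..1} (h n) = integral {a..1} (\<lambda>t. binomial_sum y n t * f t) - integral {a..1} g"
        unfolding h_def by (intro integral_diff B(1) ga)
      also have "norm \<dots> \<le> norm (integral {a..1} (\<lambda>t. binomial_sum y n t * f t)) + norm (integral {a..1} g)"
        by (rule norm_triangle_ineq4)
      also have "\<dots> \<le> 4 * (norm (binomial_sum y n a) + 3 * (?H 1 - ?H a)) * \<epsilon> + \<epsilon>"
        using B(2) e[of a 1] a by (intro add_mono) (auto simp: a_def)
      also have "\<dots> \<le> 4 * (1 + C + 3 * (D * 2)) * \<epsilon> + \<epsilon>"
        using Sa Ha e0 by (intro add_mono mult_right_mono mult_left_mono) auto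
      finally show ?thesis by (simp add: a_def algebra_simps)
    qed
    then show ?thesis
      using C(1) D0 by (intro exI[of _ "4 * (1 + C + 6 * D) + 1"]) auto
  qed
  then obtain L where L: "L \<ge> 0"
    "\<And>n \<epsilon>. n > 0 \<Longrightarrow> (\<And>s t. 1 - 1 / real n \<le> s \<Longrightarrow> s \<le> t \<Longrightarrow> t \<le> 1 \<Longrightarrow>
        norm (integral {s..t} f) \<le> \<epsilon> \<and> norm (integral {s..t} g) \<le> \<epsilon>) \<Longrightarrow>
      norm (integral {1 - 1 / real n..1} (h n)) \<le> L * \<epsilon>"
    by metis
  \<comment> \<open>Three intervals, cut at \<open>c\<close> and 1 - 1/n, with \<open>c\<close>
    chosen before n. On the first, the variation of \<open>\<psi> n\<close> tends to 0 while
    integrals of \<open>g\<close> are bounded by \<open>M\<close>; on the second, the variation is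
    at most \<open>C\<close> and integrals of \<open>g\<close> are at most
    \<open>\<epsilon>\<close>, giving 4 * (C + 3 * C); the third is \<open>tail\<close>.\<close>
  have small: "\<forall>\<^sub>F n in sequentially. norm (integral {0..1} (h n)) \<le> (1 + 16 * C + L) * \<epsilon>" if e: "\<epsilon> > 0" for \<epsilon>
  proof -
    obtain cf where cf: "0 < cf" "cf < 1"
      "\<And>s t. cf \<le> s \<Longrightarrow> s \<le> t \<Longrightarrow> t \<le> 1 \<Longrightarrow> norm (integral {s..t} f) \<le> \<epsilon>"
      using integral_norm_bound_near_right[OF f zero_less_one e] by blast
    obtain cg where cg: "0 < cg" "cg < 1"
      "\<And>s t. cg \<le> s \<Longrightarrow> s \<le> t \<Longrightarrow> t \<le> 1 \<Longrightarrow> norm (integral {s..t} g) \<le> \<epsilon>"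
      using integral_norm_bound_near_right[OF gi zero_less_one e] by blast
    define c where "c = max cf cg"
    have c: "0 < c" "c < 1" using cf cg by (auto simp: c_def)
    have ce: "norm (integral {s..t} f) \<le> \<epsilon> \<and> norm (integral {s..t} g) \<le> \<epsilon>"
      if "c \<le> s" "s \<le> t" "t \<le> 1" for s t
      using cf(3)[of s t] cg(3)[of s t] that by (auto simp: c_def)
    have "(\<lambda>n. 12 * (C * (1 - c) powr (Re y - 1)) * M * c ^ Suc n) \<longlonglongrightarrow> 12 * (C * (1 - c) powr (Re y - 1)) * M * 0"
      using c by (intro tendsto_mult tendsto_const LIMSEQ_Suc LIMSEQ_power_zero) auto
    then have ev1: "\<forall>\<^sub>F n in sequentially. 12 * (C * (1 - c) powr (Re y - 1)) * M * c ^ Suc n < \<epsilon>"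
      using e by (intro order_tendstoD(2)) auto
    have "(\<lambda>n. 1 / real n) \<longlonglongrightarrow> 0" by (rule lim_1_over_n)
    then have ev2: "\<forall>\<^sub>F n in sequentially. 1 / real n < 1 - c"
      using c by (intro order_tendstoD(2)) auto
    from ev1 ev2 eventually_gt_at_top[of 0] show ?thesis
    proof eventually_elim
      case (elim n)
      define a where "a = 1 - 1 / real n"
      have a: "c \<le> a" "a \<le> 1" using elim by (auto simp: a_def)
      have "norm (integral {0..c} (h n)) \<le> \<epsilon>"
      proof -
        let ?K = "C * real n powr Re y * (1 - c) powr (Re y - 1) / real (Suc n)"
        let ?H = "\<lambda>t. ?K * t ^ Suc n"
        have "norm (integral {0..c} (h n)) = norm (integral {0..c} (\<lambda>t. \<psi> n t * g t))"
          using c by (simp add: hpsi)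
        also have "\<dots> \<le> 4 * (norm (\<psi> n 0) + 3 * (?H c - ?H 0)) * M"
        proof (rule integral_mult_bv_bound(2))
          show "g integrable_on {0..c}" using integrable_on_subinterval[OF gi] c by auto
          show "norm (\<psi> n t - \<psi> n s) \<le> ?H t - ?H s" if "0 \<le> s" "s \<le> t" "t \<le> c" for s t
            using var[of n s t c] that c elim by blast
        qed (use c M in auto)
        also have "\<dots> = 12 * M * c ^ Suc n * ?K"
          by (simp add: psi0 del: of_nat_Suc)
        also have "\<dots> \<le> 12 * M * c ^ Suc n * (C * (1 - c) powr (Re y - 1))"
        proof (rule mult_left_mono)
          \<comment> \<open>Here \<open>Re y < 1\<close> keeps n powr Re y below n + 1, so the
            geometric factor c ^ (n + 1) decides.\<close>
          have "real n powr Re y \<le> real n powr 1"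
            using elim y by (intro powr_mono) auto
          then have "real n powr Re y / real (Suc n) \<le> 1"
            using elim by simp
          then have "(C * (1 - c) powr (Re y - 1)) * (real n powr Re y / real (Suc n)) \<le> (C * (1 - c) powr (Re y - 1)) * 1"
            using C(1) by (intro mult_left_mono) auto
          then show "?K \<le> C * (1 - c) powr (Re y - 1)"
            by (simp add: mult_ac del: of_nat_Suc)
        qed (use M c in auto)
        also have "\<dots> \<le> \<epsilon>"
          using elim by (simp add: mult_ac)
        finally show ?thesis .
      qed
      moreover have "norm (integral {c..a} (h n)) \<le> 16 * C * \<epsilon>"
      proof -
        let ?H = "\<lambda>t. C * t ^ Suc n"
        have "norm (integral {c..a} (h n)) = norm (integral {c..a} (\<lambda>t. \<psi> n t * g t))"
          using c a by (simp add: hpsi)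
        also have "\<dots> \<le> 4 * (norm (\<psi> n c) + 3 * (?H a - ?H c)) * \<epsilon>"
        proof (rule integral_mult_bv_bound(2))
          show "g integrable_on {c..a}" using integrable_on_subinterval[OF gi] c a by auto
          show "norm (\<psi> n t - \<psi> n s) \<le> ?H t - ?H s" if "c \<le> s" "s \<le> t" "t \<le> a" for s t
            using that c elim a by (intro var') (auto simp: a_def)
        qed (use c a ce in auto)
        also have "\<dots> \<le> 4 * (C + 3 * C) * \<epsilon>"
        proof -
          have "norm (\<psi> n c) \<le> C" using psi_bound[of n c] c a elim by (auto simp: a_def)
          moreover have "C * a ^ Suc n \<le> C * 1" and "0 \<le> C * c ^ Suc n"
            using C(1) c a by (auto intro!: mult_left_mono power_le_one simp del: power_Suc)
          ultimately show ?thesis using e by (intro mult_right_mono mult_left_mono add_mono) auto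
        qed
        finally show ?thesis by simp
      qed
      moreover have "norm (integral {a..1} (h n)) \<le> L * \<epsilon>"
        unfolding a_def using elim a ce by (intro L(2)) (auto simp: a_def)
      moreover have "integral {0..1} (h n) = integral {0..c} (h n) + integral {c..a} (h n) + integral {a..1} (h n)"
      proof -
        have "h n integrable_on {0..a}" using integrable_on_subinterval[OF hi] c a by auto
        then show ?thesis
          using Henstock_Kurzweil_Integration.integral_combine[of 0 c a "h n"]
            Henstock_Kurzweil_Integration.integral_combine[of 0 a 1 "h n"] hi c a by auto
      qed
      ultimately show ?case
        using norm_triangle_ineq[of "integral {0..c} (h n) + integral {c..a} (h n)" "integral {a..1} (h n)"]
          norm_triangle_ineq[of "integral {0..c} (h n)" "integral {c..a} (h n)"]
        by (simp add: distrib_right)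
    qed
  qed
  have "(\<lambda>n. integral {0..1} (h n)) \<longlonglongrightarrow> 0"
  proof (rule tendstoI)
    fix e :: real assume "e > 0"
    define K where "K = 1 + 16 * C + L"
    have K: "K > 0" using C(1) L(1) by (simp add: K_def)
    have "\<forall>\<^sub>F n in sequentially. norm (integral {0..1} (h n)) \<le> K * (e / (2 * K))"
      unfolding K_def using \<open>e > 0\<close> K by (intro small) (simp add: K_def)
    then show "\<forall>\<^sub>F n in sequentially. dist (integral {0..1} (h n)) 0 < e"
      by eventually_elim (use \<open>e > 0\<close> K in \<open>simp add: field_simps\<close>)
  qed
  moreover have "integral {0..1} (h n) =
      (\<Sum>k\<le>n. pochhammer y k / fact k * integral {0..1} (\<lambda>t. of_real t ^ k * f t)) - integral {0..1} g" for n
    unfolding h_def using integral_diff[OF has_integral_integrable[OF Sf] gi]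
    by (simp add: integral_unique[OF Sf])
  ultimately show ?thesis
    unfolding sums_def_le g_def[symmetric] by (simp add: LIM_zero_iff)
qed

section \<open>Application to the ML-generalized beta function\<close>

theorem theorem2p3:
  fixes \<alpha> \<beta> \<gamma> p x y :: complex
  assumes "Re \<alpha> > 0" and "Re p > 0" and "Re x > 0" and "Re (1 - y) > 0"
    and "beta_ML_integrand \<alpha> \<beta> \<gamma> p x (1 - y) integrable_on {0..1}"
    and "beta_ML_integrand \<alpha> \<beta> \<gamma> p x 1 integrable_on {0..1}"
  shows "(\<lambda>n. pochhammer y n / fact n * beta_ML \<alpha> \<beta> \<gamma> p (x + of_nat n) 1) sums
           beta_ML \<alpha> \<beta> \<gamma> p x (1 - y)"
proof -
  let ?f = "beta_ML_integrand \<alpha> \<beta> \<gamma> p x 1"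
  \<comment> \<open>With last parameter 1 the second power in \<open>?f\<close> is 1 for t other
    than 1. At t = 1 the identity still holds, because 0 powr any exponent is 0 and both sides
    vanish.\<close>
  have g: "(\<lambda>t. ?f t * of_real (1 - t) powr (- y)) = beta_ML_integrand \<alpha> \<beta> \<gamma> p x (1 - y)"
    by (rule ext) (auto simp: beta_ML_integrand_def powr_def)
  have n: "(\<lambda>t. of_real t ^ n * ?f t) = beta_ML_integrand \<alpha> \<beta> \<gamma> p (x + of_nat n) 1" for n
  proof
    fix t :: real
    show "of_real t ^ n * ?f t = beta_ML_integrand \<alpha> \<beta> \<gamma> p (x + of_nat n) 1 t"
    \<comment> \<open>At t = 0 both sides vanish by the same convention, even when n = 0 and t ^ n
      is 1.\<close>
    proof (cases "t = 0")
      case False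
      have "of_real t powr (x + of_nat n - 1) = of_real t ^ n * (of_real t powr (x - 1) :: complex)"
        using False powr_add[of "of_real t :: complex" "of_nat n" "x - 1"] by (simp add: algebra_simps)
      then show ?thesis
        by (simp add: beta_ML_integrand_def)
    qed (simp add: beta_ML_integrand_def)
  qed
  have "Re y < 1" using assms(4) by simp
  from sums_integral_binomial_series[OF this assms(6)] show ?thesis
    unfolding g n using assms(5) by (simp add: beta_ML_def)
qed

end
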